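(* Let $F$ be a gauge on $\mathbb{R}^2$ whose unit circle $S=\{x:F(x)=1\}$ is smooth and strictly convex. Let $\gamma(s)$, $s$ in an open interval $J$, be an oriented smooth curve in $(\mathbb{R}^2,F)$ parametrized by arc length, $F(\gamma'(s))=1$, whose circular curvature $k_c$ exists, is differentiable and nowhere zero on $J$, and let $E$ be the evolute of $\gamma$. (i) If $k_c'(s)>0$ for all $s\in J$, then an involute of the evolute $E$ is $\gamma$; that is, if $s^*$ is the arc length of $E$, then there is a constant $c$ such that $E(s)+(c-s^*(s))\frac{dE}{ds^*}(s)=\gamma(s)$ for all $s\in J$. (ii) If $k_c'(s)<0$ for all $s\in J$, then a reverse involute of the reverse evolute $E^-$ is $\gamma$; that is, with $E^-(\sigma)=E(-\sigma)$ and $s^*$ the arc length of $E^-$, there is a constant $c$ such that the involute $I_{(E^-)}(\sigma)=E^-(\sigma)+(c-s^*(\sigma))\frac{dE^-}{ds^*}(\sigma)$ satisfies $I_{(E^-)}(-s)=\gamma(s)$ for all $s\in J$.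
   Context: A gauge on $\mathbb{R}^2$ is a function $F:\mathbb{R}^2\to\mathbb{R}$ with $F(x)\ge 0$, $F(x)=0\Leftrightarrow x=0$; $F(\lambda x)=\lambda F(x)$ for $\lambda>0$; $F(x+y)\le F(x)+F(y)$ (no symmetry assumed). Fix a counter-clockwise (periodic) parametrization $\varphi(t)$ of $S$ by $F$-arc length, $F(\varphi'(t))=1$. Circular curvature and evolute of $\gamma$: write $\gamma'(s)=\varphi'(t(s))$ with $t$ continuous; $k_c(s):=t'(s)$ (when $t$ is differentiable); the evolute of $\gamma$ is $E(s)=\gamma(s)-\frac{1}{k_c(s)}\varphi(t(s))$. Arc length and involutes of a regular oriented curve $\alpha(p)$: an arc length of $\alpha$ is a function $s^*(p)$ with $ds^*/dp=F(\alpha'(p))$ (determined up to an additive constant), and an involute of $\alpha$ is a curve of the form $I_\alpha(p)=\alpha(p)+(c-s^*(p))\frac{d\alpha}{ds^*}(p)$ with $c$ a constant. For an oriented curve $\alpha(t)$ the reverse curve is $\alpha^-(t)=\alpha(-t)$. *)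

theory Defs
  imports "HOL-Analysis.Analysis"
begin

definition gauge_function :: "(real^2 \<Rightarrow> real) \<Rightarrow> bool" where
  "gauge_function F \<longleftrightarrow>
     (\<forall>x. F x \<ge> 0) \<and> (\<forall>x. F x = 0 \<longleftrightarrow> x = 0) \<and>
     (\<forall>x l. l > 0 \<longrightarrow> F (l *\<^sub>R x) = l * F x) \<and>
     (\<forall>x y. F (x + y) \<le> F x + F y)"

definition unit_circle :: "(real^2 \<Rightarrow> real) \<Rightarrow> (real^2) set" where
  "unit_circle F = {x. F x = 1}"

text \<open>The unit circle bounds a convex body, so strict convexity amounts to the absence of
  nondegenerate segments.\<close>

definition strictly_convex_circle :: "(real^2) set \<Rightarrow> bool" where
  "strictly_convex_circle S \<longleftrightarrow> (\<forall>x y. closed_segment x y \<subseteq> S \<longrightarrow> x = y)"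

text \<open>Regularity does not include continuity of the derivative: the evolute of a curve whose
  circular curvature is merely differentiable need not be of class \<open>C\<^sup>1\<close>.\<close>

definition regular_curve_on :: "real set \<Rightarrow> (real \<Rightarrow> real^2) \<Rightarrow> bool" where
  "regular_curve_on I \<alpha> \<longleftrightarrow>
     (\<forall>p\<in>I. \<alpha> differentiable (at p) \<and> vector_derivative \<alpha> (at p) \<noteq> 0)"

text \<open>A simple closed curve traversed periodically. Smoothness is read as \<open>C\<^sup>1\<close>, the weakest natural
  regularity under which the notions below make sense; smoother curves are included.\<close>

definition smooth_closed_parametrization :: "(real \<Rightarrow> real^2) \<Rightarrow> (real^2) set \<Rightarrow> bool" where
  "smooth_closed_parametrization \<phi> S \<longleftrightarrow>
     \<phi> C1_differentiable_on UNIV \<and> regular_curve_on UNIV \<phi> \<and> range \<phi> = S \<and>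
     (\<exists>L>0. \<forall>t u. \<phi> t = \<phi> u \<longleftrightarrow> (\<exists>n::int. u - t = of_int n * L))"

definition smooth_closed_curve :: "(real^2) set \<Rightarrow> bool" where
  "smooth_closed_curve S \<longleftrightarrow> (\<exists>\<phi>. smooth_closed_parametrization \<phi> S)"

text \<open>Counter-clockwise means that the polar angle about the origin increases, that is, that
  \<open>det (\<phi>, \<phi>') > 0\<close>.\<close>

definition ccw_arclength_parametrization ::
    "(real^2 \<Rightarrow> real) \<Rightarrow> (real \<Rightarrow> real^2) \<Rightarrow> bool" where
  "ccw_arclength_parametrization F \<phi> \<longleftrightarrow>
     smooth_closed_parametrization \<phi> (unit_circle F) \<and>
     (\<forall>t. F (vector_derivative \<phi> (at t)) = 1) \<and>
     (\<forall>t. det (vector [\<phi> t, vector_derivative \<phi> (at t)]) > 0)"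

text \<open>For given \<open>\<phi>\<close> and \<open>\<gamma>\<close> the function \<open>t\<close> is unique up to multiples of the
  period of \<open>\<phi>\<close>, so the circular curvature and the evolute do not depend on its choice.\<close>

definition tangent_parameter ::
    "(real \<Rightarrow> real^2) \<Rightarrow> real set \<Rightarrow> (real \<Rightarrow> real^2) \<Rightarrow> (real \<Rightarrow> real) \<Rightarrow> bool" where
  "tangent_parameter \<phi> J \<gamma> t \<longleftrightarrow>
     continuous_on J t \<and>
     (\<forall>s\<in>J. vector_derivative \<gamma> (at s) = vector_derivative \<phi> (at (t s)))"

definition circular_curvature :: "(real \<Rightarrow> real) \<Rightarrow> real \<Rightarrow> real" where
  "circular_curvature t s = deriv t s"

definition evolute ::
    "(real \<Rightarrow> real^2) \<Rightarrow> (real \<Rightarrow> real) \<Rightarrow> (real \<Rightarrow> real^2) \<Rightarrow> real \<Rightarrow> real^2" where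
  "evolute \<phi> t \<gamma> s = \<gamma> s - (1 / circular_curvature t s) *\<^sub>R \<phi> (t s)"

definition arc_length_on ::
    "(real^2 \<Rightarrow> real) \<Rightarrow> real set \<Rightarrow> (real \<Rightarrow> real^2) \<Rightarrow> (real \<Rightarrow> real) \<Rightarrow> bool" where
  "arc_length_on F I \<alpha> q \<longleftrightarrow>
     (\<forall>p\<in>I. (q has_real_derivative F (vector_derivative \<alpha> (at p))) (at p))"

text \<open>\<open>d\<alpha>/dq\<close> at the parameter \<open>p\<close>: the derivative, at \<open>q p\<close>, of \<open>\<alpha>\<close> reparametrized by
  the (injective) function \<open>q\<close> on \<open>I\<close>.\<close>

definition derivative_wrt ::
    "real set \<Rightarrow> (real \<Rightarrow> real^2) \<Rightarrow> (real \<Rightarrow> real) \<Rightarrow> real \<Rightarrow> real^2" where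
  "derivative_wrt I \<alpha> q p = vector_derivative (\<lambda>u. \<alpha> (the_inv_into I q u)) (at (q p))"

definition involute ::
    "real set \<Rightarrow> (real \<Rightarrow> real^2) \<Rightarrow> (real \<Rightarrow> real) \<Rightarrow> real \<Rightarrow> real \<Rightarrow> real^2" where
  "involute I \<alpha> q c p = \<alpha> p + (c - q p) *\<^sub>R derivative_wrt I \<alpha> q p"

definition reverse_curve :: "(real \<Rightarrow> real^2) \<Rightarrow> real \<Rightarrow> real^2" where
  "reverse_curve \<alpha> p = \<alpha> (- p)"

end

theory Submission
  imports Defs
begin

text \<open>Because \<open>\<gamma>' = \<phi>' \<circ> t\<close> and \<open>t' = k\<close>, the terms in \<open>\<phi>'\<close> cancel in the derivative of
  \<open>E = \<gamma> - (1/k) \<phi>(t)\<close>, which leaves \<open>E' = (-1/k)' \<phi>(t)\<close>, a multiple of the \<open>F\<close>-unit vector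
  \<open>\<phi>(t)\<close>. If \<open>k' > 0\<close>, the arc length of \<open>E\<close> is therefore \<open>-1/k\<close> up to a constant and the unit
  tangent is \<open>\<phi>(t)\<close>, so the involute with the matching constant is \<open>E + (1/k) \<phi>(t) = \<gamma>\<close>.
  If \<open>k' < 0\<close>, the gauge, which need not be symmetric, has to be evaluated on the reversed curve, whose
  derivative is again a positive multiple of \<open>\<phi>(t)\<close>.\<close>

text \<open>A positive derivative on an interval makes \<open>q\<close> strictly increasing, so the
  chain rule with the inverse of \<open>q\<close> divides the velocity by \<open>r p\<close>. Since
  \<open>r\<close> may be discontinuous, the inverse is differentiated from its being a left inverse
  of the continuous \<open>q\<close> on an open set, not by the C1 inverse function theorem.\<close>

lemma derivative_wrt_eq:
  assumes I: "open I" "is_interval I" and p: "p \<in> I"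
    and q: "\<And>x. x \<in> I \<Longrightarrow> (q has_real_derivative r x) (at x)"
    and r: "\<And>x. x \<in> I \<Longrightarrow> 0 < r x"
    and \<alpha>: "(\<alpha> has_vector_derivative r p *\<^sub>R v) (at p)"
  shows "derivative_wrt I \<alpha> q p = v"
proof -
  have mono: "q x < q y" if "x \<in> I" "y \<in> I" "x < y" for x y
    by (rule DERIV_pos_imp_increasing[OF \<open>x < y\<close>])
       (meson I(2) mem_is_interval_1_I q r that)
  then have "inj_on q I"
    by (intro linorder_inj_onI) (auto simp: neq_iff)
  then have inv: "the_inv_into I q (q x) = x" if "x \<in> I" for x
    using that by (simp add: the_inv_into_f_f)
  have "continuous_on I q"
    using q by (meson DERIV_isCont continuous_at_imp_continuous_on)
  then have "(the_inv_into I q has_real_derivative inverse (r p)) (at (q p))"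
    unfolding has_field_derivative_def
  proof (rule has_derivative_inverse_strong[OF I(1) p])
    show "(q has_derivative (*) (r p)) (at p)"
      using q[OF p] by (simp add: has_field_derivative_def)
    show "(*) (r p) \<circ> (*) (inverse (r p)) = id"
      using r[OF p] by (simp add: fun_eq_iff)
  qed (use inv in auto)
  then have "(the_inv_into I q has_vector_derivative inverse (r p)) (at (q p))"
    by (simp add: has_real_derivative_iff_has_vector_derivative)
  then have "(\<alpha> \<circ> the_inv_into I q has_vector_derivative inverse (r p) *\<^sub>R (r p *\<^sub>R v)) (at (q p))"
    by (rule vector_diff_chain_at) (simp add: inv p \<alpha>)
  then show ?thesis
    using r[OF p] by (simp add: derivative_wrt_def o_def vector_derivative_at)
qed

text \<open>Common core of both cases: it is applied to \<open>E\<close> and to its reverse, with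
  \<open>v\<close> the point of the unit circle and \<open>w\<close> an explicit antiderivative of
  the speed \<open>r\<close>.\<close>

lemma involute_of_unit_tangent_curve:
  assumes F: "gauge_function F" and I: "open I" "is_interval I"
    and \<alpha>: "\<And>p. p \<in> I \<Longrightarrow> (\<alpha> has_vector_derivative r p *\<^sub>R v p) (at p)"
    and w: "\<And>p. p \<in> I \<Longrightarrow> (w has_real_derivative r p) (at p)"
    and r: "\<And>p. p \<in> I \<Longrightarrow> 0 < r p" and v: "\<And>p. p \<in> I \<Longrightarrow> F (v p) = 1"
  shows "regular_curve_on I \<alpha>" "arc_length_on F I \<alpha> w"
    and "arc_length_on F I \<alpha> q \<Longrightarrow> \<exists>c. \<forall>p\<in>I. involute I \<alpha> q c p = \<alpha> p - w p *\<^sub>R v p"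
proof -
  have vd: "vector_derivative \<alpha> (at p) = r p *\<^sub>R v p" if "p \<in> I" for p
    using \<alpha>[OF that] by (rule vector_derivative_at)
  \<comment> \<open>The gauge is homogeneous for positive factors only, so the sign of
    \<open>r p\<close> matters here.\<close>
  have speed: "F (vector_derivative \<alpha> (at p)) = r p" if "p \<in> I" for p
    using F r[OF that] v[OF that] by (simp add: vd that gauge_function_def)
  have "vector_derivative \<alpha> (at p) \<noteq> 0" if "p \<in> I" for p
    using F speed[OF that] r[OF that] by (metis gauge_function_def less_irrefl)
  moreover have "\<alpha> differentiable (at p)" if "p \<in> I" for p
    using \<alpha>[OF that] by (rule differentiableI_vector)
  ultimately show "regular_curve_on I \<alpha>"
    by (simp add: regular_curve_on_def)
  show "arc_length_on F I \<alpha> w"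
    using w speed by (simp add: arc_length_on_def)
  assume "arc_length_on F I \<alpha> q"
  then have q: "(q has_real_derivative r p) (at p)" if "p \<in> I" for p
    using that speed by (simp add: arc_length_on_def)
  \<comment> \<open>Two arc lengths differ by a constant on an interval. Taking this constant as the
    \<open>c\<close> of the involute turns the factor \<open>c - q p\<close> into
    \<open>- w p\<close>.\<close>
  have "\<exists>c. \<forall>p\<in>I. q p - w p = c"
  proof (rule has_field_derivative_zero_constant)
    show "convex I"
      using I(2) by (rule is_interval_convex)
    show "((\<lambda>p. q p - w p) has_field_derivative 0) (at p within I)" if "p \<in> I" for p
      using DERIV_diff[OF q[OF that] w[OF that]] by (simp add: has_field_derivative_at_within)
  qed
  then obtain c where c: "q p - w p = c" if "p \<in> I" for p
    by blast
  have "involute I \<alpha> q c p = \<alpha> p - w p *\<^sub>R v p" if "p \<in> I" for p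
    using derivative_wrt_eq[OF I that q r \<alpha>[OF that]] c[OF that]
    by (simp add: involute_def flip: scaleR_minus_left)
  then show "\<exists>c. \<forall>p\<in>I. involute I \<alpha> q c p = \<alpha> p - w p *\<^sub>R v p"
    by blast
qed

text \<open>Sharing the single vector \<open>\<phi>'\<close> between \<gamma> at \<open>s\<close>
  and \<phi> at \<open>t s\<close> expresses the tangency that defines \<open>t\<close>, and it is
  what makes the tangential terms cancel.\<close>

lemma evolute_has_vector_derivative:
  assumes \<gamma>: "(\<gamma> has_vector_derivative \<phi>') (at s)"
    and \<phi>: "(\<phi> has_vector_derivative \<phi>') (at (t s))"
    and t: "t differentiable (at s)"
    and k: "(circular_curvature t has_real_derivative k') (at s)" "circular_curvature t s \<noteq> 0"
  shows "(evolute \<phi> t \<gamma> has_vector_derivative (k' / (circular_curvature t s)\<^sup>2) *\<^sub>R \<phi> (t s)) (at s)"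
proof -
  let ?k = "circular_curvature t"
  have "(t has_vector_derivative ?k s) (at s)"
    using t unfolding circular_curvature_def
    by (metis DERIV_deriv_iff_real_differentiable has_real_derivative_iff_has_vector_derivative)
  then have "(\<phi> \<circ> t has_vector_derivative ?k s *\<^sub>R \<phi>') (at s)"
    using \<phi> by (rule vector_diff_chain_at)
  then have \<phi>t: "((\<lambda>s. \<phi> (t s)) has_vector_derivative ?k s *\<^sub>R \<phi>') (at s)"
    by (simp add: o_def)
  have "((\<lambda>s. 1 / ?k s) has_real_derivative - (k' / (?k s)\<^sup>2)) (at s)"
    by (rule derivative_eq_intros k refl | simp add: k power2_eq_square)+
  from has_vector_derivative_diff[OF \<gamma> has_vector_derivative_scaleR[OF this \<phi>t]]
  show ?thesis
    using k(2) by (simp add: evolute_def[abs_def])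
qed

theorem theorem4p2:
  fixes F :: "real^2 \<Rightarrow> real" and \<phi> \<gamma> :: "real \<Rightarrow> real^2"
    and t :: "real \<Rightarrow> real" and E :: "real \<Rightarrow> real^2" and J :: "real set"
  assumes gauge: "gauge_function F"
    and smooth: "smooth_closed_curve (unit_circle F)"
    and strict: "strictly_convex_circle (unit_circle F)"
    and param: "ccw_arclength_parametrization F \<phi>"
    and J: "open J" "is_interval J"
    and \<gamma>_smooth: "\<gamma> C1_differentiable_on J"
    and \<gamma>_unit: "\<forall>s\<in>J. F (vector_derivative \<gamma> (at s)) = 1"
    and tangent: "tangent_parameter \<phi> J \<gamma> t"
    and k_exists: "\<forall>s\<in>J. t differentiable (at s)"
    and k_diff: "\<forall>s\<in>J. circular_curvature t differentiable (at s)"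
    and k_nz: "\<forall>s\<in>J. circular_curvature t s \<noteq> 0"
    and E: "E = evolute \<phi> t \<gamma>"
  shows "((\<forall>s\<in>J. deriv (circular_curvature t) s > 0) \<longrightarrow>
           regular_curve_on J E \<and> (\<exists>q. arc_length_on F J E q) \<and>
           (\<forall>q. arc_length_on F J E q \<longrightarrow>
             (\<exists>c. \<forall>s\<in>J. involute J E q c s = \<gamma> s)))
       \<and>
         ((\<forall>s\<in>J. deriv (circular_curvature t) s < 0) \<longrightarrow>
           regular_curve_on (uminus ` J) (reverse_curve E) \<and>
           (\<exists>q. arc_length_on F (uminus ` J) (reverse_curve E) q) \<and>
           (\<forall>q. arc_length_on F (uminus ` J) (reverse_curve E) q \<longrightarrow>
             (\<exists>c. \<forall>s\<in>J. involute (uminus ` J) (reverse_curve E) q c (- s) = \<gamma> s)))"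
proof -
  let ?k = "circular_curvature t"
  let ?r = "\<lambda>s. deriv ?k s / (?k s)\<^sup>2"
  let ?w = "\<lambda>s. - (1 / ?k s)"
  let ?J = "uminus ` J"
  have k: "(?k has_real_derivative deriv ?k s) (at s)" if "s \<in> J" for s
    using k_diff that by (simp add: DERIV_deriv_iff_real_differentiable)
  have w: "(?w has_real_derivative ?r s) (at s)" if "s \<in> J" for s
    using k_nz that by (auto intro!: derivative_eq_intros k simp: power2_eq_square)
  have E': "(E has_vector_derivative ?r s *\<^sub>R \<phi> (t s)) (at s)" if "s \<in> J" for s
    unfolding E
  proof (rule evolute_has_vector_derivative)
    have "(\<gamma> has_vector_derivative vector_derivative \<gamma> (at s)) (at s)"
      using \<gamma>_smooth that by (simp add: C1_differentiable_on_eq vector_derivative_works)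
    then show "(\<gamma> has_vector_derivative vector_derivative \<phi> (at (t s))) (at s)"
      using tangent that by (simp add: tangent_parameter_def)
    show "(\<phi> has_vector_derivative vector_derivative \<phi> (at (t s))) (at (t s))"
      using param by (simp add: ccw_arclength_parametrization_def smooth_closed_parametrization_def
          regular_curve_on_def vector_derivative_works)
  qed (use k_exists k k_nz that in auto)
  have \<phi>: "F (\<phi> x) = 1" for x
    using param
    by (auto simp: ccw_arclength_parametrization_def smooth_closed_parametrization_def unit_circle_def)
  \<comment> \<open>A purely algebraic identity, valid for every \<open>s\<close>, so it can later
    rewrite under the quantifier over \<open>J\<close>.\<close>
  have \<gamma>: "E s - ?w s *\<^sub>R \<phi> (t s) = \<gamma> s" for s
    by (simp add: E evolute_def)
  have J': "open ?J" "is_interval ?J"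
    using J by (simp_all add: open_negations is_interval_neg_translationI)
  have neg: "(uminus has_real_derivative -1) (at p)" for p :: real
    by (auto intro!: derivative_eq_intros)
  have E_rev: "(reverse_curve E has_vector_derivative - ?r (- p) *\<^sub>R \<phi> (t (- p))) (at p)"
    if "p \<in> ?J" for p
    using vector_diff_chain_at[of uminus "-1" p E] E'[of "- p"] that neg[of p]
    by (auto simp: reverse_curve_def[abs_def] o_def has_real_derivative_iff_has_vector_derivative)
  \<comment> \<open>The antiderivative is reflected but not negated: the chain rule alone supplies
    the sign that matches the reversed speed.\<close>
  have w_rev: "((\<lambda>p. ?w (- p)) has_real_derivative - ?r (- p)) (at p)" if "p \<in> ?J" for p
    using DERIV_chain[of ?w _ uminus p "-1"] w[of "- p"] that neg[of p] by (auto simp: o_def)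
  show ?thesis
  proof (intro conjI[where P = "_ \<longrightarrow> _"] impI)
    assume "\<forall>s\<in>J. deriv ?k s > 0"
    then have "?r s > 0" if "s \<in> J" for s
      using k_nz that by simp
    note * = involute_of_unit_tangent_curve[OF gauge J E' w this \<phi>]
    show "regular_curve_on J E \<and> (\<exists>q. arc_length_on F J E q) \<and>
      (\<forall>q. arc_length_on F J E q \<longrightarrow> (\<exists>c. \<forall>s\<in>J. involute J E q c s = \<gamma> s))"
      using * unfolding \<gamma> by blast
  next
    assume "\<forall>s\<in>J. deriv ?k s < 0"
    then have r: "- ?r (- p) > 0" if "p \<in> ?J" for p
      using k_nz that by (auto simp: divide_less_0_iff)
    note * = involute_of_unit_tangent_curve[OF gauge J' E_rev w_rev r \<phi>]
    \<comment> \<open>The involute at parameter \<open>p\<close> of the reverse is \<gamma> at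
      \<open>- p\<close>; putting \<open>p = - s\<close> gives the claim on
      \<open>J\<close>.\<close>
    have "reverse_curve E p - ?w (- p) *\<^sub>R \<phi> (t (- p)) = \<gamma> (- p)" for p
      unfolding reverse_curve_def by (rule \<gamma>)
    then have "\<exists>c. \<forall>p\<in>?J. involute ?J (reverse_curve E) q c p = \<gamma> (- p)"
      if "arc_length_on F ?J (reverse_curve E) q" for q
      using *(3)[OF _ _ _ that] by metis
    then show "regular_curve_on ?J (reverse_curve E) \<and>
      (\<exists>q. arc_length_on F ?J (reverse_curve E) q) \<and>
      (\<forall>q. arc_length_on F ?J (reverse_curve E) q \<longrightarrow>
        (\<exists>c. \<forall>s\<in>J. involute ?J (reverse_curve E) q c (- s) = \<gamma> s))"
      using *(1,2) by fastforce
  qed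
qed

end
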